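(* Let $U$ and $X$ be real Hilbert spaces, let $N\ge 1$ and $\widetilde p\ge 1$ be integers, and let $\Theta$ denote either $X\times U$ or $X$. Let $H:U^N\to U^N$ be a bounded self-adjoint positive semidefinite operator, let $G:U^N\to\mathbb R^{\widetilde p}$ and $S:\Theta\to\mathbb R^{\widetilde p}$ be bounded linear operators, and let $W\in\mathbb R^{\widetilde p}$. For $\theta\in\Theta$ consider the problem $$(\mathrm{QP}_\theta)\qquad \text{minimize } \tfrac12\langle H\mathbf z,\mathbf z\rangle \text{ over } \mathbf z\in U^N \text{ subject to } W+S\theta-G\mathbf z\ge 0 .$$ Let $\mathbf P=\{1,\dots,\widetilde p\}$, let $\emptyset\ne\mathbf A\subset\mathbf P$, and let $\mathbf A^c=\mathbf P\setminus\mathbf A$. For $\theta\in\Theta$, $\mathbf z_*\in U^N$ and $\lambda^{\mathbf A}\in\mathbb R^{\#\mathbf A}$ consider the conditions $$(\mathrm{KKT})\qquad W^{\mathbf A}+S^{\mathbf A}\theta=G^{\mathbf A}\mathbf z_*,\quad W^{\mathbf A^c}+S^{\mathbf A^c}\theta\ge G^{\mathbf A^c}\mathbf z_*,\quad \lambda^{\mathbf A}\ge 0,\quad H\mathbf z_*=-(G^{\mathbf A})^*\lambda^{\mathbf A}.$$ Then the following hold. 1. If $\mathbf A$, $\theta\in\Theta$, $\mathbf z_*\in U^N$ and $\lambda^{\mathbf A}\in\mathbb R^{\#\mathbf A}$ satisfy $(\mathrm{KKT})$, then $\mathbf z_*$ is a global minimizer of $(\mathrm{QP}_\theta)$, and the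 set of constraints active at $\mathbf z_*$ contains $\mathbf A$. 2. Conversely, if $\mathbf z_*$ minimizes $(\mathrm{QP}_\theta)$ and $\mathbf A$ is the set of all constraints active at $\mathbf z_*$, then there exists $\lambda\in\mathbb R^{\widetilde p}$ with $\lambda^{\mathbf A^c}=0$ such that $\mathbf A,\theta,\mathbf z_*,\lambda^{\mathbf A}$ satisfy $(\mathrm{KKT})$, and moreover $W^{\mathbf A^c}+S^{\mathbf A^c}\theta>G^{\mathbf A^c}\mathbf z_*$. 3. If $H$ is coercive and $\mathbf A,\theta,\mathbf z_*,\lambda^{\mathbf A}$ satisfy $(\mathrm{KKT})$, then $(\mathrm{QP}_\theta)$ has a unique minimizer, which is $$\mathbf z_*=H^{-1}(G^{\mathbf A})^*\big(G^{\mathbf A}H^{-1}(G^{\mathbf A})^*\big)^{[-1]}(W^{\mathbf A}+S^{\mathbf A}\theta),$$ and there is some $k\in\ker\big((G^{\mathbf A})^*\big)$ such that $$\lambda^{\mathbf A}=-\big(G^{\mathbf A}H^{-1}(G^{\mathbf A})^*\big)^{[-1]}(W^{\mathbf A}+S^{\mathbf A}\theta)+k,$$ where the two summands on the right-hand side are orthogonal in $\mathbb R^{\#\mathbf A}$.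
   Context: Inequalities between vectors in $\mathbb R^m$ (both $\ge$ and $>$) are understood componentwise. $\mathbb R^m$ carries the Euclidean inner product, $U^N$ the product Hilbert space inner product, and $*$ denotes the Hilbert space adjoint. For an index set $\mathbf B\subset\{1,\dots,\widetilde p\}$, $\#\mathbf B$ is its number of elements, and for a vector $v\in\mathbb R^{\widetilde p}$ (respectively an operator $T$ with values in $\mathbb R^{\widetilde p}$), $v^{\mathbf B}\in\mathbb R^{\#\mathbf B}$ (respectively $T^{\mathbf B}$, with values in $\mathbb R^{\#\mathbf B}$) denotes $v$ (respectively $T$) with only the components indexed by $\mathbf B$ kept, in increasing order. Conditions on an empty collection of components are vacuous. Constraint $k\in\{1,\dots,\widetilde p\}$ is active at $\mathbf z$ (for the parameter $\theta$) if the $k$-th component of $W+S\theta-G\mathbf z$ is zero. $H$ is coercive if $H^*=H$ and there is $\varepsilon>0$ with $\langle H\mathbf u,\mathbf u\rangle\ge\varepsilon\|\mathbf u\|^2$ for all $\mathbf u\in U^N$; then $H$ has a bounded inverse $H^{-1}$. For a self-adjoint matrix $P$ on $\mathbb R^m$, the pseudoinverse $P^{[-1]}$ has domain $\operatorname{ran}(P)$ and is defined as the inverse of the restriction of $P$ to $\ker(P)^\perp$, i.e. $P^{[-1]}:=\big(P|_{\ker(P)^\perp}\big)^{-1}:\operatorname{ran}(P)\to\ker(P)^\perp$. Part of the assertion in item 3 is that $W^{\mathbf A}+S^{\mathbf A}\theta$ lies in the domain of the pseudoinverse used there. *)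

theory Defs
  imports "HOL-Analysis.Analysis"
begin

(* Constraints are indexed by a finite linearly ordered type 'p, playing the role of {1..p}.
   For A :: 'p set, the space R^(#A) is real^'m with CARD('m) = card A, and comp_index A is the
   increasing enumeration of A by the index type 'm.  It is well defined only if the cardinalities
   agree, in particular only for nonempty A. *)

definition comp_index :: "'p::{finite,linorder} set \<Rightarrow> 'm::{finite,linorder} \<Rightarrow> 'p" where
  "comp_index A = (THE e. strict_mono e \<and> range e = A)"

lemma comp_index_ex1:
  fixes A :: "'p::{finite,linorder} set"
  assumes "card A = CARD('m::{finite,linorder})"
  shows "\<exists>!e :: 'm \<Rightarrow> 'p. strict_mono e \<and> range e = A"
proof (rule ex_ex1I)
  define pos where "pos m = card {..<m}" for m :: 'm
  define e where "e m = sorted_list_of_set A ! pos m" for m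
  have pos_less: "pos m < card A" for m
    unfolding pos_def assms by (rule psubset_card_mono) auto
  have pos_mono: "pos m < pos n" if "m < n" for m n
    unfolding pos_def using that by (intro psubset_card_mono) auto
  have sm: "strict_mono e"
    unfolding e_def
    by (intro strict_monoI sorted_wrt_nth_less[OF strict_sorted_list_of_set])
      (auto simp: pos_mono pos_less)
  have "range e \<subseteq> A"
    using pos_less nth_mem[of _ "sorted_list_of_set A"] by (fastforce simp: e_def)
  moreover have "card (range e) = card A"
    using card_image[OF strict_mono_imp_inj_on[OF sm]] assms by simp
  ultimately have "range e = A"
    by (simp add: card_subset_eq)
  with sm show "\<exists>e :: 'm \<Rightarrow> 'p. strict_mono e \<and> range e = A" by blast
next
  have map_enum: "map e (sorted_list_of_set UNIV) = sorted_list_of_set A"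
    if "strict_mono e \<and> range e = A" for e :: "'m \<Rightarrow> 'p"
  proof (rule strict_sorted_equal)
    show "sorted_wrt (<) (map e (sorted_list_of_set UNIV))"
      unfolding sorted_wrt_map
      by (rule sorted_wrt_mono_rel[OF _ strict_sorted_list_of_set])
        (use that in \<open>auto simp: strict_mono_def\<close>)
  qed (use that in auto)
  fix e e' :: "'m \<Rightarrow> 'p"
  assume "strict_mono e \<and> range e = A" "strict_mono e' \<and> range e' = A"
  then have "map e (sorted_list_of_set UNIV) = map e' (sorted_list_of_set UNIV)"
    by (simp only: map_enum)
  then show "e = e'"
    by (simp add: map_eq_conv fun_eq_iff)
qed

definition comps :: "'p set \<Rightarrow> real^('p::{finite,linorder}) \<Rightarrow> real^('m::{finite,linorder})" where
  "comps A v = (\<chi> i. v $ comp_index A i)"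

(* The order on real^'p is the componentwise one. *)

definition qp_minimizer ::
  "(('u::real_inner)^'n \<Rightarrow> 'u^'n) \<Rightarrow> ('u^'n \<Rightarrow> real^'p) \<Rightarrow> ('th \<Rightarrow> real^'p) \<Rightarrow> real^'p \<Rightarrow> 'th \<Rightarrow> 'u^'n \<Rightarrow> bool"
  where "qp_minimizer H G S W \<theta> z \<longleftrightarrow>
    is_arg_min (\<lambda>z. 1/2 * (H z \<bullet> z)) (\<lambda>z. W + S \<theta> - G z \<ge> 0) z"

definition active_set ::
  "(('u::real_inner)^'n \<Rightarrow> real^'p) \<Rightarrow> ('th \<Rightarrow> real^'p) \<Rightarrow> real^'p \<Rightarrow> 'th \<Rightarrow> 'u^'n \<Rightarrow> 'p set"
  where "active_set G S W \<theta> z = {k. (W + S \<theta> - G z) $ k = 0}"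

(* The components indexed by the complement of A, a possibly empty set, are compared one by one,
   because real^'m is never zero-dimensional. *)

definition KKT ::
  "(('u::real_inner)^'n \<Rightarrow> 'u^'n) \<Rightarrow> ('u^'n \<Rightarrow> real^('p::{finite,linorder})) \<Rightarrow> ('th \<Rightarrow> real^('p::{finite,linorder})) \<Rightarrow>
    real^('p::{finite,linorder}) \<Rightarrow> 'p set \<Rightarrow> 'th \<Rightarrow> 'u^'n \<Rightarrow> real^('m::{finite,linorder}) \<Rightarrow> bool"
  where "KKT H G S W A \<theta> z lam \<longleftrightarrow>
    (comps A W + comps A (S \<theta>) :: real^('m::{finite,linorder})) = comps A (G z) \<and>
    (\<forall>k\<in>-A. W $ k + S \<theta> $ k \<ge> G z $ k) \<and>
    lam \<ge> 0 \<and>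
    H z = - adjoint (\<lambda>u. comps A (G u)) lam"

definition coercive :: "('a::real_inner \<Rightarrow> 'a) \<Rightarrow> bool" where
  "coercive H \<longleftrightarrow> adjoint H = H \<and> (\<exists>\<epsilon>>0. \<forall>u. H u \<bullet> u \<ge> \<epsilon> * (norm u)\<^sup>2)"

(* Inverse of the restriction of P to the orthogonal complement of its kernel; meaningful for
   self-adjoint P and only at arguments in range P. *)

definition pseudoinverse :: "(real^'m \<Rightarrow> real^'m) \<Rightarrow> real^'m \<Rightarrow> real^'m" where
  "pseudoinverse P = the_inv_into ({x. P x = 0}\<^sup>\<bottom>) P"

end

theory Submission
  imports Defs
begin

text \<open>
  For a KKT point \<open>z\<close> and a feasible \<open>y\<close>, complementary slackness gives
  \<open>H z \<bullet> (y - z) \<ge> 0\<close>, hence \<open>H y \<bullet> y \<ge> H z \<bullet> z + H (y - z) \<bullet> (y - z)\<close>: optimality, and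
  uniqueness when \<open>H\<close> is coercive. Conversely, a minimizer \<open>z\<close> satisfies \<open>H z \<bullet> d \<ge> 0\<close> in
  every direction \<open>d\<close> that decreases no active slack, and Farkas' lemma yields the multipliers.
  In the coercive case \<open>w = P (- lam)\<close> and \<open>ker P = ker GA\<^sup>*\<close>, so \<open>- lam\<close> splits orthogonally
  into the pseudoinverse at \<open>w\<close> and an element of \<open>ker GA\<^sup>*\<close>, which does not contribute to
  \<open>z = H\<^sup>-\<^sup>1 (GA\<^sup>* (- lam))\<close>. The adjoints exist by the Riesz theorem, obtained as a special case of
  the Lax-Milgram theorem.
\<close>

section \<open>Quadratic forms, coercive operators and adjoints on Hilbert spaces\<close>

text \<open>Dividing by \<open>t > 0\<close> and letting \<open>t\<close> tend to 0 leaves only the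
  linear term. This extracts the first-order condition both for the functional \<open>J\<close>
  below and for a constrained minimizer.\<close>

lemma nonneg_of_quadratic_nonneg:
  fixes a b \<delta> :: real
  assumes "\<delta> > 0" and "\<And>t. 0 < t \<Longrightarrow> t < \<delta> \<Longrightarrow> 0 \<le> 2 * t * b + t\<^sup>2 * a"
  shows "b \<ge> 0"
proof -
  have "((\<lambda>t. 2 * b + t * a) \<longlongrightarrow> 2 * b + 0 * a) (at_right 0)"
    by (intro tendsto_intros)
  moreover have "\<forall>\<^sub>F t in at_right 0. 0 \<le> 2 * b + t * a"
  proof -
    have "0 \<le> 2 * b + t * a" if "0 < t" "t < \<delta>" for t
    proof -
      have "0 \<le> t * (2 * b + t * a)"
        using assms(2)[OF that] by (simp add: algebra_simps power2_eq_square)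
      then show ?thesis using that by (simp add: zero_le_mult_iff)
    qed
    then show ?thesis
      using assms(1) by (auto simp: eventually_at_right[of 0 \<delta>])
  qed
  ultimately have "0 \<le> 2 * b + 0 * a"
    by (rule tendsto_lowerbound) simp
  then show ?thesis by simp
qed

lemma quadratic_form_add:
  fixes H :: "'a::real_inner \<Rightarrow> 'a"
  assumes "linear H" and "\<And>x y. H x \<bullet> y = x \<bullet> H y"
  shows "H (x + y) \<bullet> (x + y) = H x \<bullet> x + 2 * (H x \<bullet> y) + H y \<bullet> y"
proof -
  have "H y \<bullet> x = H x \<bullet> y"
    using assms(2) inner_commute by metis
  then show ?thesis
    by (simp add: linear_add[OF assms(1)] inner_add_left inner_add_right)
qed

text \<open>
  The solution is the minimizer of \<open>H x \<bullet> x - 2 * f x\<close>; by the parallelogram law every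
  minimizing sequence is Cauchy.
\<close>
lemma lax_milgram_symmetric:
  fixes H :: "'a::{real_inner,complete_space} \<Rightarrow> 'a"
  assumes H: "bounded_linear H" and sym: "\<And>x y. H x \<bullet> y = x \<bullet> H y"
    and eps: "\<epsilon> > 0" "\<And>u. H u \<bullet> u \<ge> \<epsilon> * (norm u)\<^sup>2"
    and f: "bounded_linear f"
  obtains u where "\<And>v. H u \<bullet> v = f v"
proof -
  have lH: "linear H" and lf: "linear f"
    using H f by (simp_all add: bounded_linear.linear)
  define J where "J x = H x \<bullet> x - 2 * f x" for x
  have J_add: "J (x + y) = J x + 2 * (H x \<bullet> y - f y) + H y \<bullet> y" for x y
    unfolding J_def quadratic_form_add[OF lH sym] by (simp add: linear_add[OF lf])
  have J_scale: "J (u + t *\<^sub>R v) = J u + 2 * t * (H u \<bullet> v - f v) + t\<^sup>2 * (H v \<bullet> v)" for u t v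
    unfolding J_add by (simp add: linear_scale[OF lf] linear_scale[OF lH] algebra_simps power2_eq_square)
  have parallelogram: "J x + J (x + 2 *\<^sub>R y) = 2 * J (x + y) + 2 * (H y \<bullet> y)" for x y
    unfolding J_add by (simp add: linear_scale[OF lf] linear_scale[OF lH] algebra_simps)
  obtain C where C: "\<And>x. norm (f x) \<le> norm x * C"
    using f bounded_linear.bounded by blast
  have below: "J x \<ge> - (C\<^sup>2 / \<epsilon>)" for x
  proof -
    \<comment> \<open>Completing the square bounds \<open>J\<close> below, so its infimum
      \<open>m\<close> is a genuine lower bound.\<close>
    have "0 \<le> (\<epsilon> * norm x - C)\<^sup>2 / \<epsilon>"
      using eps(1) by simp
    also have "\<dots> = \<epsilon> * (norm x)\<^sup>2 - 2 * (norm x * C) + C\<^sup>2 / \<epsilon>"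
      using eps(1) by (simp add: field_simps power2_eq_square)
    finally show ?thesis
      using eps(2)[of x] C[of x] unfolding J_def by (simp add: abs_le_iff)
  qed
  define m where "m = Inf (range J)"
  have m: "m \<le> J x" for x
    unfolding m_def using below by (auto intro!: cInf_lower bdd_belowI2)
  have "\<exists>x. J x < m + 1 / real (Suc n)" for n
  proof -
    have "Inf (range J) < m + 1 / real (Suc n)"
      unfolding m_def by simp
    then show ?thesis
      using cInf_lessD[of "range J"] by auto
  qed
  then obtain X where X: "\<And>n. J (X n) < m + 1 / real (Suc n)"
    by metis
  \<comment> \<open>With \<open>d\<close> half of \<open>y - x\<close>, the point
    \<open>x + d\<close> is the midpoint, where \<open>J\<close> is at least \<open>m\<close>; the
    parallelogram identity then bounds the form at \<open>d\<close> by the two excesses over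
    \<open>m\<close>.\<close>
  have dist_bound: "\<epsilon> / 2 * (dist x y)\<^sup>2 \<le> (J x - m) + (J y - m)" for x y
  proof -
    define d where "d = (1/2) *\<^sub>R (y - x)"
    have y: "y = x + 2 *\<^sub>R d"
      unfolding d_def by simp
    have "dist x y = 2 * norm d"
      unfolding y by (simp add: dist_norm)
    then have "\<epsilon> / 2 * (dist x y)\<^sup>2 = 2 * (\<epsilon> * (norm d)\<^sup>2)"
      by (simp add: power2_eq_square)
    also have "\<dots> \<le> 2 * (H d \<bullet> d)"
      using eps(2)[of d] by simp
    also have "\<dots> \<le> (J x - m) + (J y - m)"
      using parallelogram[of x d] m[of "x + d"] unfolding y by linarith
    finally show ?thesis .
  qed
  have "Cauchy X"
  proof (rule metric_CauchyI)
    fix r :: real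
    assume r: "r > 0"
    \<comment> \<open>Two excesses below \<open>\<epsilon> / 4 * r\<^sup>2\<close> add up to less
      than the \<open>\<epsilon> / 2 * r\<^sup>2\<close> that \<open>dist_bound\<close> calls
      for.\<close>
    obtain M where M: "1 / real (Suc M) < \<epsilon> / 4 * r\<^sup>2"
      using eps(1) r nat_approx_posE[of "\<epsilon> / 4 * r\<^sup>2"] by auto
    have small: "J (X n) - m < \<epsilon> / 4 * r\<^sup>2" if "n \<ge> M" for n
    proof -
      have "1 / real (Suc n) \<le> 1 / real (Suc M)"
        using that by (intro divide_left_mono) auto
      then show ?thesis
        using X[of n] M by linarith
    qed
    have "dist (X a) (X b) < r" if "a \<ge> M" "b \<ge> M" for a b
    proof -
      have "\<epsilon> / 2 * (dist (X a) (X b))\<^sup>2 < \<epsilon> / 2 * r\<^sup>2"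
        using dist_bound[of "X a" "X b"] small[OF that(1)] small[OF that(2)] by linarith
      then have "(dist (X a) (X b))\<^sup>2 < r\<^sup>2"
        using eps(1) by simp
      then show ?thesis
        using r by (simp add: power_less_imp_less_base)
    qed
    then show "\<exists>M. \<forall>a\<ge>M. \<forall>b\<ge>M. dist (X a) (X b) < r" by blast
  qed
  then obtain u where u: "X \<longlonglongrightarrow> u"
    by (auto simp: Cauchy_convergent_iff convergent_def)
  have "(\<lambda>n. J (X n)) \<longlonglongrightarrow> J u"
    unfolding J_def
    by (intro tendsto_intros bounded_linear.tendsto[OF H] bounded_linear.tendsto[OF f] u)
  moreover have "(\<lambda>n. m + 1 / real (Suc n)) \<longlonglongrightarrow> m + 0"
    by (intro tendsto_intros LIMSEQ_Suc lim_1_over_n)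
  ultimately have "J u \<le> m + 0"
    by (rule LIMSEQ_le) (use X less_imp_le in blast)
  then have min: "J u \<le> J x" for x
    using m[of x] by simp
  \<comment> \<open>Minimality on the ray from \<open>u\<close> along \<open>v\<close> gives one
    inequality; applying it to \<open>- v\<close> as well gives equality.\<close>
  have ge: "H u \<bullet> v - f v \<ge> 0" for v
  proof (rule nonneg_of_quadratic_nonneg)
    fix t :: real
    show "0 \<le> 2 * t * (H u \<bullet> v - f v) + t\<^sup>2 * (H v \<bullet> v)"
      using min[of "u + t *\<^sub>R v"] unfolding J_scale by simp
  qed (rule zero_less_one)
  have "H u \<bullet> v = f v" for v
    using ge[of v] ge[of "- v"] by (simp add: linear_neg[OF lf])
  then show thesis by (rule that)
qed

text \<open>Since \<open>adjoint\<close> is a choice operator, its defining property must be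
  witnessed first. The witness is the Riesz representative of each functional
  \<open>f x \<bullet> y\<close>: the symmetric Lax-Milgram lemma for the identity, with constant
  1.\<close>

lemma adjoint_works_hilbert:
  fixes f :: "'a::{real_inner,complete_space} \<Rightarrow> 'b::real_inner"
  assumes f: "bounded_linear f"
  shows "x \<bullet> adjoint f y = f x \<bullet> y"
proof -
  have "\<exists>u. \<forall>x. u \<bullet> x = f x \<bullet> y" for y
  proof -
    have "bounded_linear (\<lambda>x. f x \<bullet> y)"
      by (rule bounded_linear_compose[OF bounded_linear_inner_left f])
    then show ?thesis
      using lax_milgram_symmetric[of "\<lambda>x::'a. x" 1 "\<lambda>x. f x \<bullet> y"]
      by (auto simp: power2_norm_eq_inner bounded_linear_ident)
  qed
  then obtain g where "\<And>x y. g y \<bullet> x = f x \<bullet> y"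
    by metis
  then have "\<forall>x y. f x \<bullet> y = x \<bullet> g y"
    by (metis inner_commute)
  then have "\<forall>x y. f x \<bullet> y = x \<bullet> adjoint f y"
    unfolding adjoint_def by (rule someI[where P = "\<lambda>g. \<forall>x y. f x \<bullet> y = x \<bullet> g y"])
  then show ?thesis by simp
qed

lemma adjoint_linear_hilbert:
  fixes f :: "'a::{real_inner,complete_space} \<Rightarrow> 'b::real_inner"
  assumes "bounded_linear f"
  shows "linear (adjoint f)"
proof (rule linearI)
  note [simp] = adjoint_works_hilbert[OF assms]
  show "adjoint f (x + y) = adjoint f x + adjoint f y" for x y
    by (subst vector_eq_ldot[symmetric]) (simp add: inner_add_right)
  show "adjoint f (c *\<^sub>R x) = c *\<^sub>R adjoint f x" for c x
    by (subst vector_eq_ldot[symmetric]) simp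
qed

text \<open>Makes \<open>inv H\<close> a true two-sided inverse. Coercivity forces a trivial kernel,
  and solving the variational equation for the functional \<open>v\<close> to
  \<open>y \<bullet> v\<close> gives a preimage of \<open>y\<close>.\<close>

lemma coercive_bij:
  fixes H :: "'a::{real_inner,complete_space} \<Rightarrow> 'a"
  assumes H: "bounded_linear H" and "coercive H"
  shows "bij H"
proof -
  have adj: "adjoint H = H"
    using assms(2) by (simp add: coercive_def)
  have sym: "H x \<bullet> y = x \<bullet> H y" for x y
    using adjoint_works_hilbert[OF H] unfolding adj by simp
  obtain \<epsilon> where eps: "\<epsilon> > 0" "\<And>u. H u \<bullet> u \<ge> \<epsilon> * (norm u)\<^sup>2"
    using assms(2) unfolding coercive_def by blast
  have "x = 0" if "H x = 0" for x
    using eps(2)[of x] eps(1) that by (simp add: mult_le_0_iff)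
  then have "inj H"
    using linear_injective_0[OF bounded_linear.linear[OF H]] by blast
  moreover have "\<exists>u. H u = y" for y
  proof -
    obtain u where "\<And>v. H u \<bullet> v = y \<bullet> v"
      using lax_milgram_symmetric[OF H sym eps bounded_linear_inner_right] by metis
    then show ?thesis
      using vector_eq_rdot by blast
  qed
  then have "surj H"
    by (metis surjI)
  ultimately show ?thesis
    by (rule bijI)
qed

section \<open>Farkas' lemma for finitely many linear functionals\<close>

text \<open>
  Induction on the number of functionals, without any topology: if \<open>f\<close> is positive at some
  \<open>d\<^sub>0\<close> where all functionals but \<open>g j\<close> are nonpositive, apply the induction hypothesis to the
  functionals composed with the projection along \<open>d\<^sub>0\<close> onto the kernel of \<open>g j\<close>.
\<close>
lemma farkas_linear_functionals:
  fixes f :: "'a::real_vector \<Rightarrow> real" and g :: "'i \<Rightarrow> 'a \<Rightarrow> real"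
  assumes "finite I" and "linear f" and "\<And>i. i \<in> I \<Longrightarrow> linear (g i)"
    and "\<And>d. (\<And>i. i \<in> I \<Longrightarrow> g i d \<le> 0) \<Longrightarrow> f d \<le> 0"
  shows "\<exists>l. (\<forall>i\<in>I. l i \<ge> 0) \<and> (\<forall>d. f d = (\<Sum>i\<in>I. l i * g i d))"
  using assms
proof (induction I arbitrary: f g rule: finite_induct)
  case empty
  have "f d = 0" for d
    using empty(3)[of d] empty(3)[of "- d"] by (simp add: linear_neg[OF empty(1)])
  then show ?case by simp
next
  case (insert j I)
  note lf = insert.prems(1) and lg = insert.prems(2)
  show ?case
  proof (cases "\<forall>d. (\<forall>i\<in>I. g i d \<le> 0) \<longrightarrow> f d \<le> 0")
    case True
    then have "\<exists>l. (\<forall>i\<in>I. l i \<ge> 0) \<and> (\<forall>d. f d = (\<Sum>i\<in>I. l i * g i d))"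
      by (intro insert.IH lf lg) simp_all
    then obtain l where l: "\<forall>i\<in>I. l i \<ge> 0" "\<forall>d. f d = (\<Sum>i\<in>I. l i * g i d)"
      by (elim exE conjE)
    have "f d = (\<Sum>i\<in>insert j I. (l(j := 0)) i * g i d)" for d
      unfolding l(2)[rule_format] sum.insert[OF insert.hyps]
      using insert.hyps(2) by (auto intro!: sum.cong)
    moreover have "\<forall>i\<in>insert j I. (l(j := 0)) i \<ge> 0"
      using l(1) by simp
    ultimately show ?thesis
      by (intro exI[of _ "l(j := 0)"] conjI allI)
  next
    case False
    then obtain e where e: "\<And>i. i \<in> I \<Longrightarrow> g i e \<le> 0" "f e > 0"
      by (auto simp: not_le)
    \<comment> \<open>Otherwise \<open>e\<close> would satisfy every constraint in
      \<open>insert j I\<close>, contradicting \<open>f e > 0\<close>.\<close>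
    have ge: "g j e > 0"
    proof (rule ccontr)
      assume "\<not> g j e > 0"
      then have "f e \<le> 0"
        using e(1) by (intro insert.prems(3)) auto
      with e(2) show False by simp
    qed
    \<comment> \<open>The projection along \<open>e\<close> onto the kernel of \<open>g j\<close>.
      At \<open>\<pi> d\<close> the constraint \<open>j\<close> holds with equality, so only those
      in \<open>I\<close> remain to be checked.\<close>
    define \<pi> where "\<pi> d = d - (g j d / g j e) *\<^sub>R e" for d
    have along: "h (\<pi> d) = h d - g j d / g j e * h e" if "linear h" for h :: "'a \<Rightarrow> real" and d
      unfolding \<pi>_def by (simp add: linear_diff[OF that] linear_scale[OF that])
    have lin: "linear (\<lambda>d. h (\<pi> d))" if "linear h" for h :: "'a \<Rightarrow> real"
      unfolding along[OF that]
      by (rule linearI)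
        (simp_all add: linear_add[OF that] linear_scale[OF that] linear_add[OF lg[of j]]
          linear_scale[OF lg[of j]] algebra_simps add_divide_distrib)
    have "\<exists>l. (\<forall>i\<in>I. l i \<ge> 0) \<and> (\<forall>d. f (\<pi> d) = (\<Sum>i\<in>I. l i * g i (\<pi> d)))"
    proof (rule insert.IH)
      show "linear (\<lambda>d. f (\<pi> d))"
        by (rule lin[OF lf])
      show "linear (\<lambda>d. g i (\<pi> d))" if "i \<in> I" for i
        using that by (intro lin lg insertI2)
      fix d
      assume *: "\<And>i. i \<in> I \<Longrightarrow> g i (\<pi> d) \<le> 0"
      have "g j (\<pi> d) = 0"
        using ge by (simp add: along lg)
      then show "f (\<pi> d) \<le> 0"
        using * by (intro insert.prems(3)) auto
    qed
    then obtain l where l: "\<And>i. i \<in> I \<Longrightarrow> l i \<ge> 0" "\<And>d. f (\<pi> d) = (\<Sum>i\<in>I. l i * g i (\<pi> d))"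
      by auto
    \<comment> \<open>The multiplier of \<open>g j\<close> is forced by evaluating the desired
      identity at \<open>e\<close>. It is nonnegative because \<open>f e > 0\<close> while the sum
      is at most 0.\<close>
    define c where "c = (f e - (\<Sum>i\<in>I. l i * g i e)) / g j e"
    have "(\<Sum>i\<in>I. l i * g i e) \<le> 0"
      using l(1) e(1) by (intro sum_nonpos) (simp add: mult_nonneg_nonpos)
    then have "c \<ge> 0"
      unfolding c_def using e(2) ge by simp
    then have "\<forall>i\<in>insert j I. (l(j := c)) i \<ge> 0"
      using l(1) by simp
    moreover have "f d = (\<Sum>i\<in>insert j I. (l(j := c)) i * g i d)" for d
    proof -
      have "f (\<pi> d) = (\<Sum>i\<in>I. l i * g i d - g j d / g j e * (l i * g i e))"
        unfolding l(2) by (intro sum.cong) (simp_all add: along lg algebra_simps)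
      also have "\<dots> = (\<Sum>i\<in>I. l i * g i d) - g j d / g j e * (\<Sum>i\<in>I. l i * g i e)"
        by (simp add: sum_subtractf sum_distrib_left)
      finally have "f d = (\<Sum>i\<in>I. l i * g i d) - g j d / g j e * (\<Sum>i\<in>I. l i * g i e)
          + g j d / g j e * f e"
        by (simp add: along lf)
      also have "\<dots> = c * g j d + (\<Sum>i\<in>I. l i * g i d)"
        unfolding c_def by (simp add: diff_divide_distrib algebra_simps)
      also have "\<dots> = (\<Sum>i\<in>insert j I. (l(j := c)) i * g i d)"
        unfolding sum.insert[OF insert.hyps]
        using insert.hyps(2) by (auto intro!: sum.cong)
      finally show ?thesis .
    qed
    ultimately show ?thesis
      by (intro exI[of _ "l(j := c)"] conjI allI)
  qed
qed

section \<open>Componentwise form of the restriction to \<open>A\<close> and of the minimization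
  problem\<close>

lemma bij_betw_comp_index:
  fixes A :: "'p::{finite,linorder} set"
  assumes "card A = CARD('m::{finite,linorder})"
  shows "bij_betw (comp_index A :: 'm \<Rightarrow> 'p) UNIV A"
proof -
  have "strict_mono (comp_index A :: 'm \<Rightarrow> 'p) \<and> range (comp_index A :: 'm \<Rightarrow> 'p) = A"
    unfolding comp_index_def by (rule theI'[OF comp_index_ex1[OF assms]])
  then show ?thesis
    by (simp add: bij_betw_def strict_mono_imp_inj_on)
qed

lemma ball_comp_index:
  fixes A :: "'p::{finite,linorder} set"
  assumes "card A = CARD('m::{finite,linorder})"
  shows "(\<forall>k\<in>A. Q k) \<longleftrightarrow> (\<forall>i::'m. Q (comp_index A i))"
proof -
  have "(\<forall>k\<in>range (comp_index A :: 'm \<Rightarrow> 'p). Q k) \<longleftrightarrow> (\<forall>i::'m. Q (comp_index A i))"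
    by simp
  then show ?thesis
    unfolding bij_betw_imp_surj_on[OF bij_betw_comp_index[OF assms]] .
qed

lemma bounded_linear_comps: "bounded_linear (comps A)"
  by (intro linear_conv_bounded_linear[THEN iffD1] linearI) (simp_all add: comps_def vec_eq_iff)

lemma inner_comps:
  fixes A :: "'p::{finite,linorder} set"
  assumes "card A = CARD('m::{finite,linorder})"
  shows "(comps A v :: real^('m::{finite,linorder})) \<bullet> comps A w = (\<Sum>k\<in>A. v $ k * w $ k)"
  unfolding comps_def inner_vec_def
  using sum.reindex_bij_betw[OF bij_betw_comp_index[OF assms], of "\<lambda>k. v $ k * w $ k"] by simp

lemma comps_eq_iff:
  fixes A :: "'p::{finite,linorder} set"
  assumes "card A = CARD('m::{finite,linorder})"
  shows "(comps A v :: real^('m::{finite,linorder})) = comps A w \<longleftrightarrow> (\<forall>k\<in>A. v $ k = w $ k)"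
  by (simp add: ball_comp_index[OF assms] comps_def vec_eq_iff)

lemma comps_le_iff:
  fixes A :: "'p::{finite,linorder} set"
  assumes "card A = CARD('m::{finite,linorder})"
  shows "(comps A v :: real^('m::{finite,linorder})) \<le> comps A w \<longleftrightarrow> (\<forall>k\<in>A. v $ k \<le> w $ k)"
  by (simp add: ball_comp_index[OF assms] comps_def less_eq_vec_def)

lemma qp_minimizer_iff:
  "qp_minimizer H G S W \<theta> z \<longleftrightarrow>
    (\<forall>k. G z $ k \<le> W $ k + S \<theta> $ k) \<and>
    (\<forall>y. (\<forall>k. G y $ k \<le> W $ k + S \<theta> $ k) \<longrightarrow> H z \<bullet> z \<le> H y \<bullet> y)"
  unfolding qp_minimizer_def is_arg_min_def by (auto simp: less_eq_vec_def not_less)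

section \<open>The pseudoinverse and the kernel\<close>

text \<open>Split \<open>x = p + k\<close> along the orthogonal complement of the kernel and the
  kernel itself. Then \<open>P x = P p\<close>, and \<open>P\<close> is injective on the complement,
  so inverting the restriction at \<open>P x\<close> returns \<open>p\<close>.\<close>

lemma pseudoinverse_split:
  fixes P :: "real^'m \<Rightarrow> real^'m"
  assumes P: "linear P"
  obtains k where "P k = 0" and "x = pseudoinverse P (P x) + k"
    and "orthogonal (pseudoinverse P (P x)) k"
proof -
  let ?K = "{x. P x = 0}"
  have K: "subspace ?K"
    by (rule linear_subspace_kernel[OF P])
  obtain p k where pk: "x = p + k" "p \<in> ?K\<^sup>\<bottom>" "k \<in> ?K"
    using subspace_sum_orthogonal_comp[OF K] by (metis UNIV_I add.commute set_plus_elim)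
  have "inj_on P (?K\<^sup>\<bottom>)"
  proof (rule inj_onI)
    fix a b
    assume ab: "a \<in> ?K\<^sup>\<bottom>" "b \<in> ?K\<^sup>\<bottom>" "P a = P b"
    then have "a - b \<in> ?K\<^sup>\<bottom>" "a - b \<in> ?K"
      by (simp_all add: subspace_orthogonal_comp subspace_diff linear_diff[OF P])
    then have "orthogonal (a - b) (a - b)"
      by (auto simp: orthogonal_comp_def)
    then show "a = b"
      by (simp add: orthogonal_def)
  qed
  moreover have "P x = P p"
    using pk by (simp add: linear_add[OF P])
  ultimately have p: "pseudoinverse P (P x) = p"
    unfolding pseudoinverse_def using pk(2) by (simp add: the_inv_into_f_f)
  have "orthogonal p k"
    using pk(2,3) unfolding orthogonal_comp_def by (simp add: orthogonal_commute)
  moreover have "P k = 0"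
    using pk(3) by simp
  ultimately show thesis
    using that pk(1) unfolding p by blast
qed

section \<open>Optimality conditions and the explicit minimizer\<close>

theorem theorem5:
  fixes H :: "'u::{real_inner,complete_space}^'n \<Rightarrow> 'u^'n"
    and G :: "'u^'n \<Rightarrow> real^('p::{finite,linorder})"
    and S :: "'th::{real_inner,complete_space} \<Rightarrow> real^('p::{finite,linorder})"
    and W :: "real^('p::{finite,linorder})"
    and A :: "'p set"
  assumes "bounded_linear H" and "adjoint H = H" and "\<And>z. H z \<bullet> z \<ge> 0"
    and "bounded_linear G" and "bounded_linear S"
    and "A \<noteq> {}" and "card A = CARD('m)"
  shows
    "(\<forall>\<theta> z (lam :: real^('m::{finite,linorder})). KKT H G S W A \<theta> z lam \<longrightarrow>
        qp_minimizer H G S W \<theta> z \<and> A \<subseteq> active_set G S W \<theta> z)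
   \<and> (\<forall>\<theta> z. qp_minimizer H G S W \<theta> z \<and> A = active_set G S W \<theta> z \<longrightarrow>
        (\<exists>lam :: real^('p::{finite,linorder}). (\<forall>k\<in>-A. lam $ k = 0) \<and>
           KKT H G S W A \<theta> z (comps A lam :: real^('m::{finite,linorder}))) \<and>
        (\<forall>k\<in>-A. W $ k + S \<theta> $ k > G z $ k))
   \<and> (\<forall>\<theta> z (lam :: real^('m::{finite,linorder})). coercive H \<and> KKT H G S W A \<theta> z lam \<longrightarrow>
        (let GA = (\<lambda>u. comps A (G u)) :: 'u^'n \<Rightarrow> real^('m::{finite,linorder});
             P = GA \<circ> inv H \<circ> adjoint GA;
             w = comps A W + comps A (S \<theta>)
         in (\<forall>y. qp_minimizer H G S W \<theta> y \<longleftrightarrow> y = z) \<and>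
            w \<in> range P \<and>
            z = inv H (adjoint GA (pseudoinverse P w)) \<and>
            (\<exists>k. adjoint GA k = 0 \<and>
                 lam = - pseudoinverse P w + k \<and>
                 orthogonal (- pseudoinverse P w) k)))"
proof -
  define GA :: "'u^'n \<Rightarrow> real^('m::{finite,linorder})" where "GA = (\<lambda>u. comps A (G u))"
  note card = \<open>card A = CARD('m)\<close>
  note lH = bounded_linear.linear[OF assms(1)] and lG = bounded_linear.linear[OF assms(4)]
  have sym: "H x \<bullet> y = x \<bullet> H y" for x y
    using adjoint_works_hilbert[OF assms(1)] by (simp add: assms(2))
  have bGA: "bounded_linear GA"
    unfolding GA_def by (rule bounded_linear_compose[OF bounded_linear_comps assms(4)])
  note lGA = bounded_linear.linear[OF bGA]
  note adj = adjoint_works_hilbert[OF bGA]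
  have KKT_iff: "KKT H G S W A \<theta> z lam \<longleftrightarrow>
      (\<forall>k\<in>A. W $ k + S \<theta> $ k = G z $ k) \<and> (\<forall>k\<in>-A. W $ k + S \<theta> $ k \<ge> G z $ k) \<and>
      lam \<ge> 0 \<and> H z = - adjoint GA lam" for \<theta> z and lam :: "real^('m::{finite,linorder})"
    unfolding KKT_def GA_def using comps_eq_iff[OF card, of "W + S \<theta>"]
    by (simp add: linear_add[OF bounded_linear.linear[OF bounded_linear_comps]])
  have growth: "H z \<bullet> z + H (y - z) \<bullet> (y - z) \<le> H y \<bullet> y"
    if kkt: "KKT H G S W A \<theta> z lam" and y: "\<forall>k. G y $ k \<le> W $ k + S \<theta> $ k"
    for \<theta> z y and lam :: "real^('m::{finite,linorder})"
  proof -
    \<comment> \<open>On \<open>A\<close> the constraints are tight at \<open>z\<close>, so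
      feasibility of \<open>y\<close> compares \<open>GA y\<close> with \<open>GA z\<close>. Pairing
      with \<open>lam\<close> and using stationarity then yields the sign of
      \<open>H z \<bullet> (y - z)\<close>.\<close>
    have "GA y \<le> GA z"
      using kkt y unfolding GA_def comps_le_iff[OF card] KKT_iff by metis
    then have "0 \<le> lam \<bullet> (GA z - GA y)"
      using kkt unfolding KKT_iff inner_vec_def
      by (auto simp: less_eq_vec_def intro!: sum_nonneg mult_nonneg_nonneg)
    also have "\<dots> = H z \<bullet> (y - z)"
      using kkt adj[of "y - z" lam] unfolding KKT_iff
      by (simp add: linear_diff[OF lGA] inner_commute[of _ "y - z"] inner_commute[of lam]
          inner_diff_left)
    finally show ?thesis
      using quadratic_form_add[OF lH sym, of z "y - z"] by simp
  qed
  have sufficient: "qp_minimizer H G S W \<theta> z \<and> A \<subseteq> active_set G S W \<theta> z"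
    if kkt: "KKT H G S W A \<theta> z lam" for \<theta> z and lam :: "real^('m::{finite,linorder})"
  proof -
    have "G z $ k \<le> W $ k + S \<theta> $ k" for k
      using kkt unfolding KKT_iff by (cases "k \<in> A") auto
    moreover have "H z \<bullet> z \<le> H y \<bullet> y" if "\<forall>k. G y $ k \<le> W $ k + S \<theta> $ k" for y
      using growth[OF kkt that] assms(3)[of "y - z"] by simp
    ultimately show ?thesis
      using kkt unfolding qp_minimizer_iff KKT_iff active_set_def by auto
  qed
  have necessary: "(\<exists>lam :: real^('p::{finite,linorder}). (\<forall>k\<in>-A. lam $ k = 0) \<and>
           KKT H G S W A \<theta> z (comps A lam :: real^('m::{finite,linorder}))) \<and>
        (\<forall>k\<in>-A. W $ k + S \<theta> $ k > G z $ k)"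
    if qp: "qp_minimizer H G S W \<theta> z" and A: "A = active_set G S W \<theta> z" for \<theta> z
  proof -
    have active: "W $ k + S \<theta> $ k = G z $ k" if "k \<in> A" for k
      using that unfolding A active_set_def by simp
    have inactive: "G z $ k < W $ k + S \<theta> $ k" if "k \<notin> A" for k
    proof -
      have "G z $ k \<noteq> W $ k + S \<theta> $ k"
        using that unfolding A active_set_def by simp
      moreover have "G z $ k \<le> W $ k + S \<theta> $ k"
        using qp unfolding qp_minimizer_iff by blast
      ultimately show ?thesis by simp
    qed
    have "- (H z \<bullet> d) \<le> 0" if d: "\<And>k. k \<in> A \<Longrightarrow> G d $ k \<le> 0" for d
    proof -
      \<comment> \<open>Short steps along \<open>d\<close> stay feasible: active slacks do not
        decrease, inactive ones are strictly positive and survive small \<open>t\<close>, and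
        finitely many constraints share one bound \<open>\<delta>\<close>.\<close>
      have ray: "G (z + t *\<^sub>R d) $ k = G z $ k + t * G d $ k" for t k
        by (simp add: linear_add[OF lG] linear_scale[OF lG])
      have "\<forall>\<^sub>F t in at_right 0. G (z + t *\<^sub>R d) $ k \<le> W $ k + S \<theta> $ k" for k
      proof (cases "k \<in> A")
        case True
        have "\<forall>\<^sub>F t :: real in at_right 0. 0 < t"
          by (rule eventually_at_right_less)
        then show ?thesis
          by eventually_elim (simp add: ray active True d mult_nonneg_nonpos)
      next
        case False
        have "((\<lambda>t. G z $ k + t * G d $ k) \<longlongrightarrow> G z $ k + 0 * G d $ k) (at_right 0)"
          by (intro tendsto_intros)
        then have "\<forall>\<^sub>F t in at_right 0. G z $ k + t * G d $ k < W $ k + S \<theta> $ k"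
          using inactive[OF False] by (intro order_tendstoD) auto
        then show ?thesis
          by eventually_elim (simp add: ray)
      qed
      then have "\<forall>\<^sub>F t in at_right 0. \<forall>k. G (z + t *\<^sub>R d) $ k \<le> W $ k + S \<theta> $ k"
        by (rule eventually_all_finite)
      then obtain \<delta> :: real where \<delta>: "\<delta> > 0"
        "\<And>t k. 0 < t \<Longrightarrow> t < \<delta> \<Longrightarrow> G (z + t *\<^sub>R d) $ k \<le> W $ k + S \<theta> $ k"
        by (auto simp: eventually_at_right[OF zero_less_one])
      have "H z \<bullet> d \<ge> 0"
      proof (rule nonneg_of_quadratic_nonneg[OF \<delta>(1)])
        fix t :: real
        assume "0 < t" "t < \<delta>"
        then have "H z \<bullet> z \<le> H (z + t *\<^sub>R d) \<bullet> (z + t *\<^sub>R d)"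
          using qp \<delta>(2) unfolding qp_minimizer_iff by blast
        then show "0 \<le> 2 * t * (H z \<bullet> d) + t\<^sup>2 * (H d \<bullet> d)"
          unfolding quadratic_form_add[OF lH sym]
          by (simp add: linear_scale[OF lH] power2_eq_square)
      qed
      then show ?thesis by simp
    qed
    moreover have "linear (\<lambda>d. - (H z \<bullet> d))" and "linear (\<lambda>d. G d $ k)" for k
      by (auto intro!: linearI simp: inner_add_right linear_add[OF lG] linear_scale[OF lG])
    ultimately obtain l where l: "\<forall>k\<in>A. l k \<ge> 0" "\<And>d. - (H z \<bullet> d) = (\<Sum>k\<in>A. l k * G d $ k)"
      using farkas_linear_functionals[of A "\<lambda>d. - (H z \<bullet> d)" "\<lambda>k d. G d $ k"] by auto
    \<comment> \<open>The Farkas multipliers live on \<open>A\<close> only; extending them by zero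
      gives the vector indexed by all constraints.\<close>
    define lam :: "real^('p::{finite,linorder})" where "lam = (\<chi> k. if k \<in> A then l k else 0)"
    have "H z \<bullet> d = - adjoint GA (comps A lam) \<bullet> d" for d
    proof -
      have "adjoint GA (comps A lam) \<bullet> d = comps A lam \<bullet> GA d"
        using adj[of d] by (simp add: inner_commute)
      also have "\<dots> = (\<Sum>k\<in>A. l k * G d $ k)"
        unfolding GA_def inner_comps[OF card] by (simp add: lam_def)
      finally show ?thesis
        using l(2)[of d] by simp
    qed
    then have "H z = - adjoint GA (comps A lam)"
      using vector_eq_rdot by blast
    moreover have "(comps A lam :: real^('m::{finite,linorder})) \<ge> 0"
      using comps_le_iff[OF card, of 0 lam] l(1) by (simp add: lam_def comps_def zero_vec_def)
    ultimately have "KKT H G S W A \<theta> z (comps A lam :: real^('m::{finite,linorder}))"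
      unfolding KKT_iff using active inactive by (auto intro: less_imp_le)
    moreover have "\<forall>k\<in>-A. lam $ k = 0"
      by (simp add: lam_def)
    ultimately show ?thesis
      using inactive by auto
  qed
  have explicit: "(\<forall>y. qp_minimizer H G S W \<theta> y \<longleftrightarrow> y = z) \<and> w \<in> range P \<and>
      z = inv H (adjoint GA (pseudoinverse P w)) \<and>
      (\<exists>k. adjoint GA k = 0 \<and> lam = - pseudoinverse P w + k \<and>
         orthogonal (- pseudoinverse P w) k)"
    if coer: "coercive H" and kkt: "KKT H G S W A \<theta> z lam"
      and P_def: "P = GA \<circ> inv H \<circ> adjoint GA" and w_def: "w = comps A W + comps A (S \<theta>)"
    for \<theta> z P w and lam :: "real^('m::{finite,linorder})"
  proof -
    obtain \<epsilon> where eps: "\<epsilon> > 0" "\<And>u. H u \<bullet> u \<ge> \<epsilon> * (norm u)\<^sup>2"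
      using coer unfolding coercive_def by blast
    have definite: "u = 0" if "H u \<bullet> u \<le> 0" for u
    proof -
      have "\<epsilon> * (norm u)\<^sup>2 \<le> 0"
        using eps(2)[of u] that by simp
      then show ?thesis
        using eps(1) by (simp add: mult_le_0_iff)
    qed
    have bij: "bij H"
      using assms(1) coer by (rule coercive_bij)
    have HinvH: "H (inv H x) = x" and invHH: "inv H (H x) = x" for x
      using bij by (simp_all add: bij_is_surj surj_f_inv_f bij_is_inj)
    have linv: "linear (inv H)"
    proof (rule linearI)
      show "inv H (x + y) = inv H x + inv H y" for x y
        by (metis HinvH invHH linear_add[OF lH])
      show "inv H (c *\<^sub>R x) = c *\<^sub>R inv H x" for c x
        by (metis HinvH invHH linear_scale[OF lH])
    qed
    have ladj: "linear (adjoint GA)"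
      by (rule adjoint_linear_hilbert[OF bGA])
    have lP: "linear P"
      unfolding P_def by (intro linear_compose ladj linv lGA)
    \<comment> \<open>For \<open>u = inv H (adjoint GA k)\<close>, the form
      \<open>H u \<bullet> u\<close> equals \<open>GA u \<bullet> k = P k \<bullet> k = 0\<close>,
      so \<open>u = 0\<close> and hence \<open>adjoint GA k = H u = 0\<close>.\<close>
    have Pk: "adjoint GA k = 0" if "P k = 0" for k
    proof -
      define u where "u = inv H (adjoint GA k)"
      have "H u \<bullet> u = GA u \<bullet> k"
        using adj[of u k] by (simp add: u_def HinvH inner_commute)
      also have "GA u = 0"
        using that by (simp add: P_def u_def)
      finally have "u = 0"
        by (intro definite) simp
      then show ?thesis
        using HinvH[of "adjoint GA k"] by (simp add: u_def[symmetric] linear_0[OF lH])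
    qed
    have Hz: "H z = adjoint GA (- lam)"
      using kkt by (simp add: KKT_iff linear_neg[OF ladj])
    \<comment> \<open>Tightness on \<open>A\<close> says \<open>w = GA z\<close>, and stationarity
      gives \<open>z = inv H (adjoint GA (- lam))\<close>. This also places \<open>w\<close> in the
      range of \<open>P\<close>.\<close>
    have w: "w = P (- lam)"
      using kkt by (simp add: P_def Hz[symmetric] invHH) (simp add: w_def KKT_def GA_def)
    obtain k where k: "P k = 0" "- lam = pseudoinverse P w + k"
      "orthogonal (pseudoinverse P w) k"
      using pseudoinverse_split[OF lP, of "- lam"] unfolding w by metis
    have "z = inv H (adjoint GA (- lam))"
      using invHH[of z] by (simp add: Hz)
    also have "\<dots> = inv H (adjoint GA (pseudoinverse P w))"
      unfolding k(2) by (simp add: linear_add[OF ladj] Pk[OF k(1)])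
    finally have z: "z = inv H (adjoint GA (pseudoinverse P w))" .
    \<comment> \<open>The splitting was made for \<open>- lam\<close>, so the kernel summand of
      \<open>lam\<close> is \<open>- k\<close>.\<close>
    have "lam = - pseudoinverse P w + (- k)"
      using k(2) by (metis add.inverse_inverse minus_add_distrib)
    moreover have "adjoint GA (- k) = 0"
      by (simp add: linear_neg[OF ladj] Pk[OF k(1)])
    moreover have "orthogonal (- pseudoinverse P w) (- k)"
      using k(3) by (simp add: orthogonal_def)
    \<comment> \<open>Two minimizers have equal values, so \<open>growth\<close> leaves a
      nonpositive form at \<open>y - z\<close>, which definiteness forces to vanish.\<close>
    moreover have "y = z" if y: "qp_minimizer H G S W \<theta> y" for y
    proof -
      have "H y \<bullet> y \<le> H z \<bullet> z"
        using y sufficient[OF kkt] unfolding qp_minimizer_iff by blast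
      moreover have "H z \<bullet> z + H (y - z) \<bullet> (y - z) \<le> H y \<bullet> y"
        using y by (intro growth[OF kkt]) (simp add: qp_minimizer_iff)
      ultimately have "y - z = 0"
        by (intro definite) simp
      then show ?thesis by simp
    qed
    ultimately show ?thesis
      using sufficient[OF kkt] z w by blast
  qed
  show ?thesis
    unfolding Let_def GA_def[symmetric]
    using sufficient necessary explicit by blast
qed

end
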